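(* Let $\tau=(\tau_1,\dots,\tau_d):\mathbb R^d\to\mathbb R^d$ be a $C^d$ diffeomorphic map. Assume that there exist constants $B_\tau,M_\tau\ge0$ such that for every $\bm a\in\mathbb N_0^d$ with $1\le|\bm a|\le d$ and every $i=1,\dots,d$, $$|D^{\bm a}\tau_i(\bm x)|\le B_\tau\exp(M_\tau\|\bm x\|^2),\quad\forall\,\bm x\in\mathbb R^d.$$ Suppose that $g:\mathbb R^d\to\mathbb R$ satisfies the growth condition with growth rate $M_g\in\mathbb R$ and a constant $C_g>0$. Assume that there exist constants $C_\tau>0$ and $C_\tau'\in\mathbb R$ such that, for all $\bm x\in\mathbb R^d$, $\|\tau(\bm x)\|^2\le C_\tau\|\bm x\|^2+C_\tau'$ if $M_g\ge0$, and $\|\tau(\bm x)\|^2\ge C_\tau\|\bm x\|^2+C_\tau'$ if $M_g<0$. Then $g_\tau=g\circ\tau$ satisfies the growth condition with growth rate $M_{g_\tau}=M_gC_\tau+dM_\tau$.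
   Context: $\|\cdot\|$ is the Euclidean norm; for $\bm a\in\mathbb N_0^d$, $|\bm a|=a_1+\dots+a_d$ and $D^{\bm a}$ is the corresponding partial derivative. A function $g:\mathbb R^d\to\mathbb R$ satisfies the growth condition with growth rate $M\in\mathbb R$ and constant $C>0$ if $g\in C^d(\mathbb R^d)$ and $|D^{\bm a}g(\bm x)|\le C\exp\{M\|\bm x\|^2\}$ for all $\bm x\in\mathbb R^d$ and all $\bm a\in\mathbb N_0^d$ with $|\bm a|\le d$; it satisfies the growth condition with growth rate $M$ if this holds for some $C>0$. *)

theory Defs
  imports "HOL-Analysis.Analysis"
begin

text \<open>Throughout, the dimension \<open>d\<close> is \<open>CARD('n)\<close> and a multi-index is a function \<open>'n \<Rightarrow> nat\<close>.\<close>

definition partial_deriv :: "'n::finite \<Rightarrow> (real ^ 'n \<Rightarrow> 'b::real_normed_vector) \<Rightarrow> real ^ 'n \<Rightarrow> 'b" where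
  "partial_deriv i f x = vector_derivative (\<lambda>t. f (x + t *\<^sub>R axis i 1)) (at 0)"

text \<open>\<open>C_diff k f\<close> says that \<open>f\<close> is of class \<open>C\<^sup>k\<close> on the whole space. Differentiability is
  Frechet differentiability; without it the (total) operator \<open>partial_deriv\<close> carries no information.\<close>

fun C_diff :: "nat \<Rightarrow> (real ^ 'n::finite \<Rightarrow> 'b::real_normed_vector) \<Rightarrow> bool" where
  "C_diff 0 f \<longleftrightarrow> continuous_on UNIV f"
| "C_diff (Suc k) f \<longleftrightarrow> (\<forall>x. f differentiable (at x)) \<and> (\<forall>i. C_diff k (partial_deriv i f))"

definition C_diffeomorphism :: "nat \<Rightarrow> (real ^ 'n::finite \<Rightarrow> real ^ 'n) \<Rightarrow> bool" where
  "C_diffeomorphism k f \<longleftrightarrow> bij f \<and> C_diff k f \<and> C_diff k (inv f)"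

definition multi_order :: "('n::finite \<Rightarrow> nat) \<Rightarrow> nat" where
  "multi_order a = (\<Sum>i\<in>UNIV. a i)"

text \<open>A finite index type has no canonical order, so some enumeration of the coordinates is fixed.
  It only determines the order in which partial derivatives are taken, which is irrelevant for
  \<open>D\<^sup>a f\<close> whenever \<open>f\<close> is of class \<open>C\<^sup>k\<close> with \<open>k \<ge> |a|\<close>.\<close>

definition coord_list :: "'n::finite list" where
  "coord_list = (SOME is. distinct is \<and> set is = UNIV)"

lemma coord_list: "distinct (coord_list :: 'n::finite list)" "set (coord_list :: 'n list) = UNIV"
proof -
  have "\<exists>is :: 'n list. distinct is \<and> set is = UNIV"
    using finite_distinct_list[of "UNIV :: 'n set"] by auto
  then have "distinct (coord_list :: 'n list) \<and> set (coord_list :: 'n list) = UNIV"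
    unfolding coord_list_def by (rule someI_ex)
  then show "distinct (coord_list :: 'n list)" "set (coord_list :: 'n list) = UNIV"
    by auto
qed

definition multi_deriv ::
  "('n::finite \<Rightarrow> nat) \<Rightarrow> (real ^ 'n \<Rightarrow> 'b::real_normed_vector) \<Rightarrow> real ^ 'n \<Rightarrow> 'b" where
  "multi_deriv a f = foldr (\<lambda>i. partial_deriv i ^^ a i) coord_list f"

definition growth_condition_with :: "real \<Rightarrow> real \<Rightarrow> (real ^ 'n::finite \<Rightarrow> real) \<Rightarrow> bool" where
  "growth_condition_with M C g \<longleftrightarrow> C > 0 \<and> C_diff CARD('n) g \<and>
     (\<forall>x a. multi_order a \<le> CARD('n) \<longrightarrow>
        \<bar>multi_deriv a g x\<bar> \<le> C * exp (M * (norm x)\<^sup>2))"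

definition growth_condition :: "real \<Rightarrow> (real ^ 'n::finite \<Rightarrow> real) \<Rightarrow> bool" where
  "growth_condition M g \<longleftrightarrow> (\<exists>C. growth_condition_with M C g)"

end

theory Submission imports Defs begin

text \<open>Call \<open>f\<close> dominated to order \<open>m\<close> by a weight \<open>w\<close> if all its iterated partial derivatives of
  order at most \<open>m\<close>, taken in any order, are \<open>O(w)\<close>. This is inherited by sums, by products (with the
  product of the weights) and, through the chain rule, by compositions, which replaces the
  multivariate formula of Faa di Bruno. The chain rule produces derivatives in arbitrary order
  whereas the growth condition fixes one, so Schwarz's theorem is needed to pass between the two.\<close>

section \<open>Partial derivatives and the Frechet derivative\<close>

lemma partial_deriv_eq:
  assumes "(f has_derivative f') (at x)"
  shows "partial_deriv i f x = f' (axis i 1)"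
    and "((\<lambda>t. f (x + t *\<^sub>R axis i 1)) has_vector_derivative partial_deriv i f x) (at 0)"
proof -
  have "((\<lambda>t. x + t *\<^sub>R axis i 1) has_derivative (\<lambda>t. t *\<^sub>R axis i 1)) (at 0)"
    by (auto intro!: derivative_eq_intros)
  moreover have "(f has_derivative f') (at (x + 0 *\<^sub>R axis i 1))"
    using assms by simp
  ultimately have "((\<lambda>t. f (x + t *\<^sub>R axis i 1)) has_derivative (\<lambda>t. f' (t *\<^sub>R axis i 1))) (at 0)"
    using has_derivative_compose by blast
  moreover have "f' (t *\<^sub>R axis i 1) = t *\<^sub>R f' (axis i 1)" for t
    using assms has_derivative_linear linear_scale by blast
  ultimately have D: "((\<lambda>t. f (x + t *\<^sub>R axis i 1)) has_vector_derivative f' (axis i 1)) (at 0)"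
    by (simp add: has_vector_derivative_def)
  then show "partial_deriv i f x = f' (axis i 1)"
    unfolding partial_deriv_def by (rule vector_derivative_at)
  with D show "((\<lambda>t. f (x + t *\<^sub>R axis i 1)) has_vector_derivative partial_deriv i f x) (at 0)"
    by simp
qed

text \<open>Expand \<open>v\<close> in the standard basis and use linearity of the Frechet
  derivative. The outer function enters the chain rule in this form.\<close>

lemma has_derivative_partial_deriv:
  assumes "f differentiable (at x)"
  shows "(f has_derivative (\<lambda>v. \<Sum>i\<in>UNIV. v $ i *\<^sub>R partial_deriv i f x)) (at x)"
proof -
  from assms obtain f' where f': "(f has_derivative f') (at x)"
    by (auto simp: differentiable_def)
  have lin: "linear f'"
    using f' by (rule has_derivative_linear)
  have "f' v = (\<Sum>i\<in>UNIV. v $ i *\<^sub>R partial_deriv i f x)" for v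
  proof -
    have "f' v = f' (\<Sum>i\<in>UNIV. v $ i *\<^sub>R axis i 1)"
      by (simp add: basis_expansion flip: scalar_mult_eq_scaleR)
    also have "\<dots> = (\<Sum>i\<in>UNIV. v $ i *\<^sub>R f' (axis i 1))"
      by (simp add: linear_sum[OF lin] linear_scale[OF lin])
    finally show ?thesis
      by (simp add: partial_deriv_eq(1)[OF f'])
  qed
  then have "f' = (\<lambda>v. \<Sum>i\<in>UNIV. v $ i *\<^sub>R partial_deriv i f x)"
    by blast
  with f' show ?thesis
    by simp
qed

text \<open>\<open>partial_deriv\<close> is a derivative at parameter 0; moving the base point to
  \<open>x + s *\<^sub>R axis i 1\<close> turns it into a derivative at \<open>s\<close>, as the
  mean value theorem requires along a segment.\<close>

lemma has_real_derivative_along_axis: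
  fixes f :: "real ^ 'n::finite \<Rightarrow> real"
  assumes "\<And>x. f differentiable (at x)"
  shows "((\<lambda>s. f (x + s *\<^sub>R axis i 1)) has_real_derivative partial_deriv i f (x + s *\<^sub>R axis i 1)) (at s)"
proof -
  let ?y = "x + s *\<^sub>R axis i 1"
  obtain f' where "(f has_derivative f') (at ?y)"
    using assms by (auto simp: differentiable_def)
  from partial_deriv_eq(2)[OF this, of i]
  have "((\<lambda>t. f (?y + t *\<^sub>R axis i 1)) has_real_derivative partial_deriv i f ?y) (at 0)"
    by (simp add: has_real_derivative_iff_has_vector_derivative)
  then have "((\<lambda>t. f (x + (s + t) *\<^sub>R axis i 1)) has_real_derivative partial_deriv i f ?y) (at 0)"
    by (simp add: scaleR_left_distrib add.assoc)
  then show ?thesis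
    using DERIV_shift[of "\<lambda>s. f (x + s *\<^sub>R axis i 1)" _ 0 s]
    by (simp add: add.commute)
qed

section \<open>Functions of class C^k\<close>

lemma C_diff_continuous: "C_diff k f \<Longrightarrow> continuous_on UNIV f"
  by (cases k) (auto simp: continuous_on_eq_continuous_at differentiable_imp_continuous_within)

lemma C_diff_SucD: "C_diff (Suc k) f \<Longrightarrow> C_diff k f"
proof (induction k arbitrary: f)
  case 0
  then show ?case using C_diff_continuous by fastforce
next
  case (Suc k)
  then show ?case by (metis C_diff.simps(2))
qed

lemma C_diff_mono: "C_diff k f \<Longrightarrow> m \<le> k \<Longrightarrow> C_diff m f"
  by (induction k) (auto simp: le_Suc_eq dest: C_diff_SucD simp del: C_diff.simps)

text \<open>The last entry of the list is the derivative taken first, and \<open>C_diff\<close> also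
  peels off the innermost derivative; hence the induction from the end of the list.\<close>

lemma C_diff_foldr_partial_deriv: "C_diff (k + length is) f \<Longrightarrow> C_diff k (foldr partial_deriv is f)"
  by (induction "is" arbitrary: f rule: rev_induct) auto

lemma partial_deriv_nth:
  assumes "f differentiable (at x)"
  shows "partial_deriv i (\<lambda>y. f y $ j) x = partial_deriv i f x $ j"
    and "(\<lambda>y. f y $ j) differentiable (at x)"
proof -
  obtain f' where f': "(f has_derivative f') (at x)"
    using assms by (auto simp: differentiable_def)
  have "((\<lambda>y. f y $ j) has_derivative (\<lambda>v. f' v $ j)) (at x)"
    using f' by (rule bounded_linear.has_derivative[OF bounded_linear_vec_nth])
  with f' show "partial_deriv i (\<lambda>y. f y $ j) x = partial_deriv i f x $ j"
    and "(\<lambda>y. f y $ j) differentiable (at x)"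
    by (auto simp: partial_deriv_eq(1) differentiable_def)
qed

lemma C_diff_nth: "C_diff k f \<Longrightarrow> C_diff k (\<lambda>x. f x $ j)"
proof (induction k arbitrary: f)
  case 0
  then show ?case by (auto intro: continuous_on_component)
next
  case (Suc k)
  then have "partial_deriv i (\<lambda>x. f x $ j) = (\<lambda>x. partial_deriv i f x $ j)" for i
    by (auto simp: partial_deriv_nth)
  with Suc show ?case by (auto simp: partial_deriv_nth)
qed

section \<open>Schwarz's theorem\<close>

lemma second_difference_eq_mixed_partial_deriv:
  fixes f :: "real ^ 'n::finite \<Rightarrow> real"
  assumes "C_diff 2 f" "h > 0"
  shows "\<exists>y. norm (y - x) \<le> 2 * h \<and>
    f (x + h *\<^sub>R axis i 1 + h *\<^sub>R axis j 1) - f (x + h *\<^sub>R axis i 1) - f (x + h *\<^sub>R axis j 1) + f x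
      = h\<^sup>2 * partial_deriv j (partial_deriv i f) y"
proof -
  let ?e = "\<lambda>i::'n. axis i 1 :: real ^ 'n"
  have d: "\<And>x. f differentiable (at x)" "\<And>x. partial_deriv i f differentiable (at x)"
    using assms(1) by (auto simp: numeral_2_eq_2)
  \<comment> \<open>The increment of \<open>f\<close> in direction \<open>j\<close>, as a function
    of the displacement in direction \<open>i\<close>. The second difference is
    \<open>u h - u 0\<close>, so a first mean value theorem in direction \<open>i\<close> produces
    \<open>partial_deriv i f\<close>.\<close>
  define u where "u s = f ((x + h *\<^sub>R ?e j) + s *\<^sub>R ?e i) - f (x + s *\<^sub>R ?e i)" for s
  have "\<exists>z. 0 < z \<and> z < h \<and> u h - u 0 = (h - 0) *
      (partial_deriv i f ((x + h *\<^sub>R ?e j) + z *\<^sub>R ?e i) - partial_deriv i f (x + z *\<^sub>R ?e i))"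
    unfolding u_def using \<open>h > 0\<close>
    by (intro MVT2 DERIV_diff has_real_derivative_along_axis d) auto
  then obtain s where s: "0 < s" "s < h" and 1: "u h - u 0 = h *
      (partial_deriv i f ((x + h *\<^sub>R ?e j) + s *\<^sub>R ?e i) - partial_deriv i f (x + s *\<^sub>R ?e i))"
    by auto
  \<comment> \<open>A second mean value theorem, now in direction \<open>j\<close>, is applied to
    the increment of \<open>partial_deriv i f\<close> just obtained.\<close>
  have "\<exists>z. 0 < z \<and> z < h \<and>
      partial_deriv i f ((x + s *\<^sub>R ?e i) + h *\<^sub>R ?e j) - partial_deriv i f ((x + s *\<^sub>R ?e i) + 0 *\<^sub>R ?e j)
        = (h - 0) * partial_deriv j (partial_deriv i f) ((x + s *\<^sub>R ?e i) + z *\<^sub>R ?e j)"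
    using \<open>h > 0\<close> by (intro MVT2 has_real_derivative_along_axis d) auto
  then obtain t where t: "0 < t" "t < h" and 2:
      "partial_deriv i f ((x + s *\<^sub>R ?e i) + h *\<^sub>R ?e j) - partial_deriv i f (x + s *\<^sub>R ?e i)
        = h * partial_deriv j (partial_deriv i f) ((x + s *\<^sub>R ?e i) + t *\<^sub>R ?e j)"
    by auto
  let ?y = "(x + s *\<^sub>R ?e i) + t *\<^sub>R ?e j"
  have "norm (?y - x) \<le> norm (s *\<^sub>R ?e i) + norm (t *\<^sub>R ?e j)"
    using norm_triangle_ineq[of "s *\<^sub>R ?e i" "t *\<^sub>R ?e j"] by (simp add: add.assoc)
  also have "\<dots> \<le> 2 * h"
    using s t by simp
  finally have "norm (?y - x) \<le> 2 * h" .
  moreover have "u h - u 0 = h\<^sup>2 * partial_deriv j (partial_deriv i f) ?y"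
    unfolding 1 using 2 by (simp add: power2_eq_square algebra_simps)
  ultimately show ?thesis
    by (intro exI[of _ ?y]) (simp add: u_def algebra_simps)
qed

text \<open>The second difference is symmetric in the two directions, but the preceding lemma
  equates it with either mixed derivative at a nearby point, depending on the direction treated
  first. Divide by the squared step and let it tend to 0; both mixed derivatives are
  continuous.\<close>

lemma partial_deriv_commute:
  fixes f :: "real ^ 'n::finite \<Rightarrow> real"
  assumes "C_diff 2 f"
  shows "partial_deriv i (partial_deriv j f) = partial_deriv j (partial_deriv i f)"
proof
  fix x
  let ?h = "\<lambda>n. inverse (real (Suc n))"
  have lim: "\<exists>y. y \<longlonglongrightarrow> x \<and> (\<forall>n.
      f (x + ?h n *\<^sub>R axis i 1 + ?h n *\<^sub>R axis j 1) - f (x + ?h n *\<^sub>R axis i 1) - f (x + ?h n *\<^sub>R axis j 1) + f x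
        = (?h n)\<^sup>2 * partial_deriv j (partial_deriv i f) (y n))" for i j
  proof -
    have "\<forall>n. \<exists>y. norm (y - x) \<le> 2 * ?h n \<and>
      f (x + ?h n *\<^sub>R axis i 1 + ?h n *\<^sub>R axis j 1) - f (x + ?h n *\<^sub>R axis i 1) - f (x + ?h n *\<^sub>R axis j 1) + f x
        = (?h n)\<^sup>2 * partial_deriv j (partial_deriv i f) y"
      using second_difference_eq_mixed_partial_deriv[OF assms] by simp
    then obtain y where y: "\<And>n. norm (y n - x) \<le> 2 * ?h n"
      "\<And>n. f (x + ?h n *\<^sub>R axis i 1 + ?h n *\<^sub>R axis j 1) - f (x + ?h n *\<^sub>R axis i 1) - f (x + ?h n *\<^sub>R axis j 1) + f x
        = (?h n)\<^sup>2 * partial_deriv j (partial_deriv i f) (y n)"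
      by metis
    have "(\<lambda>n. 2 * ?h n) \<longlonglongrightarrow> 0"
      by (rule tendsto_mult_right_zero[OF LIMSEQ_inverse_real_of_nat])
    then have "(\<lambda>n. y n - x) \<longlonglongrightarrow> 0"
      by (rule Lim_null_comparison[OF always_eventually[OF allI[OF y(1)]]])
    then have "y \<longlonglongrightarrow> x"
      by (rule LIM_zero_cancel)
    with y(2) show ?thesis
      by blast
  qed
  obtain y where y: "y \<longlonglongrightarrow> x" "\<And>n.
      f (x + ?h n *\<^sub>R axis i 1 + ?h n *\<^sub>R axis j 1) - f (x + ?h n *\<^sub>R axis i 1) - f (x + ?h n *\<^sub>R axis j 1) + f x
        = (?h n)\<^sup>2 * partial_deriv j (partial_deriv i f) (y n)"
    using lim by blast
  obtain z where z: "z \<longlonglongrightarrow> x" "\<And>n.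
      f (x + ?h n *\<^sub>R axis j 1 + ?h n *\<^sub>R axis i 1) - f (x + ?h n *\<^sub>R axis j 1) - f (x + ?h n *\<^sub>R axis i 1) + f x
        = (?h n)\<^sup>2 * partial_deriv i (partial_deriv j f) (z n)"
    using lim by blast
  have "(?h n)\<^sup>2 * partial_deriv j (partial_deriv i f) (y n) = (?h n)\<^sup>2 * partial_deriv i (partial_deriv j f) (z n)" for n
    unfolding y(2)[symmetric] z(2)[symmetric] by (simp add: algebra_simps)
  then have eq: "partial_deriv j (partial_deriv i f) (y n) = partial_deriv i (partial_deriv j f) (z n)" for n
    by (simp del: of_nat_Suc)
  have cont: "isCont (partial_deriv i (partial_deriv j f)) x" for i j
    using assms by (auto simp: numeral_2_eq_2 continuous_on_eq_continuous_at)
  show "partial_deriv i (partial_deriv j f) x = partial_deriv j (partial_deriv i f) x"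
    using isCont_tendsto_compose[OF cont z(1), of i j] isCont_tendsto_compose[OF cont y(1), of j i]
    unfolding eq by (rule LIMSEQ_unique)
qed

section \<open>Independence of the order of differentiation, and multi-indices\<close>

lemma foldr_partial_deriv_move:
  fixes f :: "real ^ 'n::finite \<Rightarrow> real"
  assumes "C_diff (length (ys @ i # zs)) f"
  shows "foldr partial_deriv (ys @ i # zs) f = foldr partial_deriv (i # ys @ zs) f"
  using assms
proof (induction ys)
  case (Cons j ys)
  \<comment> \<open>After the induction hypothesis has moved \<open>i\<close> to the front of the
    tail, only \<open>j\<close> and \<open>i\<close> must be swapped. They act on the derivative
    along \<open>ys @ zs\<close>, whose order is two less than the full order, so it is still of
    class C^2.\<close>
  have "C_diff (2 + length (ys @ zs)) f"
    using Cons.prems by simp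
  then have "C_diff 2 (foldr partial_deriv (ys @ zs) f)"
    by (rule C_diff_foldr_partial_deriv)
  moreover have "C_diff (length (ys @ i # zs)) f"
    using Cons.prems by (rule C_diff_mono) simp
  ultimately show ?case
    using Cons.IH partial_deriv_commute[of "foldr partial_deriv (ys @ zs) f" j i] by simp
qed simp

lemma foldr_partial_deriv_permute:
  fixes f :: "real ^ 'n::finite \<Rightarrow> real"
  assumes "mset is = mset js" "C_diff (length is) f"
  shows "foldr partial_deriv is f = foldr partial_deriv js f"
  using assms
proof (induction "is" arbitrary: js)
  case (Cons i "is")
  then obtain ys zs where js: "js = ys @ i # zs"
    by (metis list.set_intros(1) mset_eq_setD split_list)
  with Cons.prems have m: "mset is = mset (ys @ zs)"
    by simp
  have "length (i # is) = length js"
    using Cons.prems(1) mset_eq_length by blast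
  with Cons.prems have "foldr partial_deriv js f = foldr partial_deriv (i # ys @ zs) f"
    unfolding js by (metis foldr_partial_deriv_move)
  moreover have "C_diff (length is) f"
    using Cons.prems(2) by (rule C_diff_mono) simp
  ultimately show ?case
    using Cons.IH[OF m] by simp
qed simp

text \<open>The multi-index as a word of directions, in exactly the order in which
  \<open>multi_deriv\<close> composes them, so that no smoothness is required to rewrite one as the
  other.\<close>

definition multi_index_list :: "('n::finite \<Rightarrow> nat) \<Rightarrow> 'n list" where
  "multi_index_list a = concat (map (\<lambda>i. replicate (a i) i) coord_list)"

lemma multi_deriv_eq_foldr: "multi_deriv a f = foldr partial_deriv (multi_index_list a) f"
proof -
  have "foldr partial_deriv (replicate n i) h = (partial_deriv i ^^ n) h" for n i and h :: "real ^ 'a \<Rightarrow> 'b"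
    by (induction n) auto
  then have "foldr (\<lambda>i. partial_deriv i ^^ a i) is f
      = foldr partial_deriv (concat (map (\<lambda>i. replicate (a i) i) is)) f" for "is"
    by (induction "is") auto
  then show ?thesis
    by (simp add: multi_deriv_def multi_index_list_def)
qed

lemma count_multi_index_list: "count (mset (multi_index_list a)) i = a i"
proof -
  \<comment> \<open>Distinctness ensures that the block of copies of \<open>i\<close> occurs only
    once.\<close>
  have "distinct is \<Longrightarrow> count (mset (concat (map (\<lambda>i. replicate (a i) i) is))) i
      = (if i \<in> set is then a i else 0)" for "is"
    by (induction "is") auto
  then show ?thesis
    by (simp add: multi_index_list_def coord_list)
qed

lemma length_multi_index_list: "length (multi_index_list a) = multi_order a"
proof -
  have "length (multi_index_list a) = sum_list (map a coord_list)"
    by (simp add: multi_index_list_def length_concat comp_def)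
  also have "\<dots> = sum a UNIV"
    by (metis coord_list sum_list_distinct_conv_sum_set)
  finally show ?thesis
    by (simp add: multi_order_def)
qed

text \<open>The way back: any word of directions is a permutation of the word of its multiplicities.
  Bounds on \<open>multi_deriv\<close> thereby reach derivatives taken in arbitrary order.\<close>

lemma multi_deriv_count:
  fixes f :: "real ^ 'n::finite \<Rightarrow> real"
  assumes "C_diff (length is) f"
  shows "multi_order (count (mset is)) = length is"
    and "multi_deriv (count (mset is)) f = foldr partial_deriv is f"
proof -
  have m: "mset (multi_index_list (count (mset is))) = mset is"
    by (rule multiset_eqI) (rule count_multi_index_list)
  then show l: "multi_order (count (mset is)) = length is"
    by (metis length_multi_index_list size_mset)
  show "multi_deriv (count (mset is)) f = foldr partial_deriv is f"
    unfolding multi_deriv_eq_foldr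
    using m assms by (intro foldr_partial_deriv_permute) (simp_all add: length_multi_index_list l)
qed

section \<open>Calculus of dominated functions\<close>

text \<open>The recursion follows \<open>C_diff\<close>, so closure properties reduce by induction
  to first-order rules. The constant may vary from one derivative to the next; its sign condition
  lets weights be enlarged.\<close>

fun dominated :: "nat \<Rightarrow> (real ^ 'n::finite \<Rightarrow> real) \<Rightarrow> (real ^ 'n \<Rightarrow> real) \<Rightarrow> bool" where
  "dominated 0 w f \<longleftrightarrow> continuous_on UNIV f \<and> (\<exists>K\<ge>0. \<forall>x. \<bar>f x\<bar> \<le> K * w x)"
| "dominated (Suc m) w f \<longleftrightarrow> (\<forall>x. f differentiable (at x)) \<and> (\<exists>K\<ge>0. \<forall>x. \<bar>f x\<bar> \<le> K * w x) \<and>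
     (\<forall>i. dominated m w (partial_deriv i f))"

lemma dominated_imp_bound: "dominated m w f \<Longrightarrow> \<exists>K\<ge>0. \<forall>x. \<bar>f x\<bar> \<le> K * w x"
  by (cases m) auto

lemma dominated_imp_C_diff: "dominated m w f \<Longrightarrow> C_diff m f"
  by (induction m arbitrary: f) auto

lemma dominated_SucD: "dominated (Suc m) w f \<Longrightarrow> dominated m w f"
proof (induction m arbitrary: f)
  case 0
  then show ?case
    by (auto simp: continuous_on_eq_continuous_at differentiable_imp_continuous_within)
next
  case (Suc m)
  then show ?case by (metis dominated.simps(2))
qed

lemma dominated_mono:
  assumes "dominated m v f" "\<And>x. v x \<le> w x"
  shows "dominated m w f"
proof -
  have *: "\<exists>K\<ge>0. \<forall>x. \<bar>h x\<bar> \<le> K * w x" if "\<exists>K\<ge>0. \<forall>x. \<bar>h x\<bar> \<le> K * v x" for h :: "real ^ 'a \<Rightarrow> real"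
    using that assms(2) by (meson mult_left_mono order_trans)
  show ?thesis
    using assms(1) by (induction m arbitrary: f) (auto intro: *)
qed

lemma dominated_imp_foldr_bound:
  assumes "dominated m w f" "\<And>x. 0 \<le> w x"
  shows "\<exists>K\<ge>0. \<forall>is x. length is \<le> m \<longrightarrow> \<bar>foldr partial_deriv is f x\<bar> \<le> K * w x"
  using assms(1)
proof (induction m arbitrary: f)
  case 0
  then show ?case by auto
next
  case (Suc m)
  obtain K where K: "K \<ge> 0" "\<And>x. \<bar>f x\<bar> \<le> K * w x"
    using dominated_imp_bound[OF Suc.prems] by blast
  have "\<forall>i. \<exists>L\<ge>0. \<forall>is x. length is \<le> m \<longrightarrow> \<bar>foldr partial_deriv is (partial_deriv i f) x\<bar> \<le> L * w x"
    using Suc by simp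
  then obtain L where L: "\<And>i. L i \<ge> 0"
      "\<And>i is x. length is \<le> m \<Longrightarrow> \<bar>foldr partial_deriv is (partial_deriv i f) x\<bar> \<le> L i * w x"
    by metis
  \<comment> \<open>One constant for all derivatives: there are finitely many directions, and a sum
    of nonnegative constants exceeds each of them.\<close>
  let ?S = "K + sum L UNIV"
  have "\<bar>foldr partial_deriv is f x\<bar> \<le> ?S * w x" if "length is \<le> Suc m" for "is" x
  proof (cases "is" rule: rev_cases)
    case Nil
    have "K * w x \<le> ?S * w x"
      using assms(2) L(1) by (intro mult_right_mono) (auto intro: sum_nonneg)
    with K(2)[of x] show ?thesis
      unfolding Nil by simp
  next
    case (snoc js i)
    have "L i \<le> sum L UNIV"
      using L(1) by (intro member_le_sum) auto
    then have "L i * w x \<le> ?S * w x"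
      using K(1) assms(2) by (intro mult_right_mono) auto
    moreover have "\<bar>foldr partial_deriv is f x\<bar> \<le> L i * w x"
      using that L(2) by (simp add: snoc)
    ultimately show ?thesis
      by simp
  qed
  moreover have "?S \<ge> 0"
    using K(1) L(1) by (simp add: sum_nonneg)
  ultimately show ?case
    by blast
qed

text \<open>Turns the uniform bounds in the hypotheses on \<open>g\<close> and \<open>\<tau>\<close>
  into domination; appending \<open>i\<close> to a word means differentiating along \<open>i\<close>
  first.\<close>

lemma foldr_bound_imp_dominated:
  assumes "C_diff m f" "K \<ge> 0"
    and "\<And>is x. length is \<le> m \<Longrightarrow> \<bar>foldr partial_deriv is f x\<bar> \<le> K * w x"
  shows "dominated m w f"
  using assms
proof (induction m arbitrary: f)
  case 0
  from "0.prems"(3)[of "[]"] "0.prems" show ?case by auto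
next
  case (Suc m)
  have "dominated m w (partial_deriv i f)" for i
  proof (rule Suc.IH)
    show "\<bar>foldr partial_deriv is (partial_deriv i f) x\<bar> \<le> K * w x" if "length is \<le> m" for "is" x
      using Suc.prems(3)[of "is @ [i]" x] that by simp
  qed (use Suc.prems in auto)
  then show ?case
    using Suc.prems Suc.prems(3)[of "[]"] by auto
qed

lemma dominated_zero: "(\<And>x. 0 \<le> w x) \<Longrightarrow> dominated m w (\<lambda>x. 0)"
proof (induction m)
  case 0
  then show ?case by (auto intro!: exI[of _ 0])
next
  case (Suc m)
  have "partial_deriv i (\<lambda>x. 0 :: real) = (\<lambda>x::real^'a. 0)" for i
    by (rule ext) (auto intro: partial_deriv_eq(1))
  with Suc show ?case by (auto intro!: exI[of _ 0])
qed

lemma dominated_add: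
  assumes "dominated m w f" "dominated m w g"
  shows "dominated m w (\<lambda>x. f x + g x)"
  using assms
proof (induction m arbitrary: f g)
  \<comment> \<open>The bound on the function itself, stated for every order so that it serves both
    cases of the induction.\<close>
  have *: "\<exists>K\<ge>0. \<forall>x. \<bar>f x + g x\<bar> \<le> K * w x" if fg: "dominated m w f" "dominated m w g" for m f g
  proof -
    obtain K L where "K \<ge> 0" "L \<ge> 0" and KL: "\<And>x. \<bar>f x\<bar> \<le> K * w x" "\<And>x. \<bar>g x\<bar> \<le> L * w x"
      using fg dominated_imp_bound by meson
    moreover have "\<bar>f x + g x\<bar> \<le> (K + L) * w x" for x
      using KL[of x] by (simp add: algebra_simps)
    ultimately show ?thesis
      by (intro exI[of _ "K + L"]) auto
  qed
  {
    case 0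
    then show ?case using *[OF 0] by (auto intro: continuous_on_add)
  next
    case (Suc m)
    have "partial_deriv i (\<lambda>x. f x + g x) = (\<lambda>x. partial_deriv i f x + partial_deriv i g x)" for i
    proof
      fix x
      obtain f' g' where "(f has_derivative f') (at x)" "(g has_derivative g') (at x)"
        using Suc.prems by (fastforce simp: differentiable_def)
      then show "partial_deriv i (\<lambda>x. f x + g x) x = partial_deriv i f x + partial_deriv i g x"
        using has_derivative_add by (fastforce simp: partial_deriv_eq(1))
    qed
    with Suc *[OF Suc.prems] show ?case by auto
  }
qed

lemma dominated_sum:
  assumes "\<And>x. 0 \<le> w x" "\<And>j. j \<in> A \<Longrightarrow> dominated m w (f j)"
  shows "dominated m w (\<lambda>x. \<Sum>j\<in>A. f j x)"
  using assms(2)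
  by (induction A rule: infinite_finite_induct) (auto intro: dominated_add dominated_zero assms(1))

lemma dominated_mult:
  assumes "dominated m v f" "dominated m w g"
  shows "dominated m (\<lambda>x. v x * w x) (\<lambda>x. f x * g x)"
  using assms
proof (induction m arbitrary: f g)
  have *: "\<exists>K\<ge>0. \<forall>x. \<bar>f x * g x\<bar> \<le> K * (v x * w x)" if fg: "dominated m v f" "dominated m w g" for m f g
  proof -
    obtain K L where "K \<ge> 0" "L \<ge> 0" and KL: "\<And>x. \<bar>f x\<bar> \<le> K * v x" "\<And>x. \<bar>g x\<bar> \<le> L * w x"
      using fg dominated_imp_bound by meson
    moreover have "\<bar>f x * g x\<bar> \<le> (K * L) * (v x * w x)" for x
    proof -
      have "\<bar>f x\<bar> * \<bar>g x\<bar> \<le> (K * v x) * (L * w x)"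
        using KL[of x] by (intro mult_mono) auto
      then show ?thesis
        by (simp add: abs_mult mult_ac)
    qed
    ultimately show ?thesis
      by (intro exI[of _ "K * L"]) auto
  qed
  {
    case 0
    then show ?case using *[OF 0] by (auto intro: continuous_on_mult)
  next
    case (Suc m)
    have "partial_deriv i (\<lambda>x. f x * g x) = (\<lambda>x. f x * partial_deriv i g x + partial_deriv i f x * g x)" for i
    proof
      fix x
      obtain f' g' where "(f has_derivative f') (at x)" "(g has_derivative g') (at x)"
        using Suc.prems by (fastforce simp: differentiable_def)
      then show "partial_deriv i (\<lambda>x. f x * g x) x = f x * partial_deriv i g x + partial_deriv i f x * g x"
        using has_derivative_mult by (fastforce simp: partial_deriv_eq(1))
    qed
    \<comment> \<open>In each Leibniz term the undifferentiated factor is lowered from order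
      \<open>Suc m\<close> to \<open>m\<close>, which makes the induction hypothesis applicable to
      both products.\<close>
    moreover have "dominated m (\<lambda>x. v x * w x) (\<lambda>x. f x * partial_deriv i g x + partial_deriv i f x * g x)" for i
      using Suc.prems Suc.prems[THEN dominated_SucD] by (intro dominated_add Suc.IH) simp_all
    moreover have "(\<lambda>x. f x * g x) differentiable (at x)" for x
      using Suc.prems by (intro differentiable_mult) auto
    ultimately show ?case
      using *[OF Suc.prems] by simp
  }
qed

section \<open>The chain rule and composition\<close>

lemma partial_deriv_compose:
  fixes \<tau> :: "real ^ 'n::finite \<Rightarrow> real ^ 'm::finite" and h :: "real ^ 'm \<Rightarrow> real"
  assumes "h differentiable (at (\<tau> x))" "\<tau> differentiable (at x)"
  shows "partial_deriv i (h \<circ> \<tau>) x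
    = (\<Sum>j\<in>UNIV. (partial_deriv j h \<circ> \<tau>) x * partial_deriv i (\<lambda>y. \<tau> y $ j) x)"
proof -
  obtain \<tau>' where \<tau>': "(\<tau> has_derivative \<tau>') (at x)"
    using assms(2) by (auto simp: differentiable_def)
  have "partial_deriv i (h \<circ> \<tau>) x
      = ((\<lambda>v. \<Sum>j\<in>UNIV. v $ j *\<^sub>R partial_deriv j h (\<tau> x)) \<circ> \<tau>') (axis i 1)"
    by (rule partial_deriv_eq(1)[OF diff_chain_at[OF \<tau>' has_derivative_partial_deriv[OF assms(1)]]])
  also have "\<dots> = (\<Sum>j\<in>UNIV. partial_deriv i \<tau> x $ j * partial_deriv j h (\<tau> x))"
    by (simp add: partial_deriv_eq(1)[OF \<tau>'])
  finally show ?thesis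
    by (simp add: partial_deriv_nth(1)[OF assms(2)] mult.commute)
qed

text \<open>The chain rule expresses \<open>\<partial>\<^sub>i (h \<circ> \<tau>)\<close> through \<open>\<partial>\<^sub>j h \<circ> \<tau>\<close> and one factor
  \<open>\<partial>\<^sub>i \<tau>\<^sub>j\<close>, so every order of differentiation costs one more factor \<open>e\<close>.\<close>

lemma dominated_compose:
  fixes \<tau> :: "real ^ 'n::finite \<Rightarrow> real ^ 'm::finite" and h :: "real ^ 'm \<Rightarrow> real"
  assumes "dominated m w h" "C_diff m \<tau>"
    and "\<And>i j k. k < m \<Longrightarrow> dominated k e (partial_deriv i (\<lambda>x. \<tau> x $ j))"
    and e: "\<And>x. 1 \<le> e x" and w: "\<And>y. 0 \<le> w y"
  shows "dominated m (\<lambda>x. w (\<tau> x) * e x ^ m) (h \<circ> \<tau>)"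
  using assms(1-3)
proof (induction m arbitrary: h)
  case 0
  then show ?case
    by (auto simp: continuous_on_eq_continuous_at intro: isCont_o2)
next
  case (Suc m)
  obtain K where K: "K \<ge> 0" "\<And>y. \<bar>h y\<bar> \<le> K * w y"
    using dominated_imp_bound[OF Suc.prems(1)] by blast
  \<comment> \<open>The undifferentiated composition carries no factor \<open>e\<close>; the full
    power can be inserted because \<open>e\<close> is at least 1.\<close>
  have "\<bar>h (\<tau> x)\<bar> \<le> K * (w (\<tau> x) * e x ^ Suc m)" for x
  proof -
    have "1 \<le> e x ^ Suc m"
      using e by (intro one_le_power)
    then have "w (\<tau> x) * 1 \<le> w (\<tau> x) * e x ^ Suc m"
      using w by (intro mult_left_mono)
    then have "K * w (\<tau> x) \<le> K * (w (\<tau> x) * e x ^ Suc m)"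
      using K(1) by (intro mult_left_mono) auto
    with K(2)[of "\<tau> x"] show ?thesis
      by linarith
  qed
  moreover have "dominated m (\<lambda>x. w (\<tau> x) * e x ^ Suc m) (partial_deriv i (h \<circ> \<tau>))" for i
  proof -
    have "partial_deriv i (h \<circ> \<tau>) = (\<lambda>x. \<Sum>j\<in>UNIV. (partial_deriv j h \<circ> \<tau>) x * partial_deriv i (\<lambda>y. \<tau> y $ j) x)"
      using Suc.prems(1,2) by (intro ext partial_deriv_compose) auto
    \<comment> \<open>The induction hypothesis for \<open>partial_deriv j h\<close> supplies
      \<open>e x ^ m\<close>, and the derivative of the component of \<open>\<tau>\<close> supplies
      the last factor.\<close>
    moreover have "dominated m (\<lambda>x. (w (\<tau> x) * e x ^ m) * e x)
        (\<lambda>x. (partial_deriv j h \<circ> \<tau>) x * partial_deriv i (\<lambda>y. \<tau> y $ j) x)" for j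
    proof (intro dominated_mult Suc.IH)
      show "C_diff m \<tau>"
        using Suc.prems(2) by (rule C_diff_SucD)
    qed (use Suc.prems in auto)
    moreover have "0 \<le> (w (\<tau> x) * e x ^ m) * e x" for x
      using w[of "\<tau> x"] e[of x] by simp
    ultimately have "dominated m (\<lambda>x. (w (\<tau> x) * e x ^ m) * e x) (partial_deriv i (h \<circ> \<tau>))"
      by (simp add: dominated_sum)
    then show ?thesis
      by (simp add: mult_ac)
  qed
  moreover have "(h \<circ> \<tau>) differentiable (at x)" for x
    using Suc.prems(1,2) by (auto intro: differentiable_chain_at)
  ultimately show ?case
    using K(1) unfolding dominated.simps comp_apply by blast
qed

section \<open>The growth rate of the composition\<close>

theorem theorem3:
  fixes \<tau> :: "real ^ 'n::finite \<Rightarrow> real ^ 'n"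
    and g :: "real ^ 'n \<Rightarrow> real"
    and B\<^sub>\<tau> M\<^sub>\<tau> M\<^sub>g C\<^sub>g C\<^sub>\<tau> C\<^sub>\<tau>' :: real
  assumes "C_diffeomorphism CARD('n) \<tau>"
    and "B\<^sub>\<tau> \<ge> 0" and "M\<^sub>\<tau> \<ge> 0"
    and "\<And>a i x. 1 \<le> multi_order a \<Longrightarrow> multi_order a \<le> CARD('n) \<Longrightarrow>
           \<bar>multi_deriv a (\<lambda>y. \<tau> y $ i) x\<bar> \<le> B\<^sub>\<tau> * exp (M\<^sub>\<tau> * (norm x)\<^sup>2)"
    and "growth_condition_with M\<^sub>g C\<^sub>g g"
    and "C\<^sub>\<tau> > 0"
    and "\<And>x. M\<^sub>g \<ge> 0 \<Longrightarrow> (norm (\<tau> x))\<^sup>2 \<le> C\<^sub>\<tau> * (norm x)\<^sup>2 + C\<^sub>\<tau>'"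
    and "\<And>x. M\<^sub>g < 0 \<Longrightarrow> (norm (\<tau> x))\<^sup>2 \<ge> C\<^sub>\<tau> * (norm x)\<^sup>2 + C\<^sub>\<tau>'"
  shows "growth_condition (M\<^sub>g * C\<^sub>\<tau> + real CARD('n) * M\<^sub>\<tau>) (g \<circ> \<tau>)"
proof -
  let ?d = "CARD('n)"
  let ?w = "\<lambda>y::real^'n. exp (M\<^sub>g * (norm y)\<^sup>2)"
  let ?e = "\<lambda>x::real^'n. exp (M\<^sub>\<tau> * (norm x)\<^sup>2)"
  have \<tau>: "C_diff ?d \<tau>"
    using assms(1) by (simp add: C_diffeomorphism_def)
  have g: "C\<^sub>g > 0" "C_diff ?d g"
      "\<And>a x. multi_order a \<le> ?d \<Longrightarrow> \<bar>multi_deriv a g x\<bar> \<le> C\<^sub>g * ?w x"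
    using assms(5) by (auto simp: growth_condition_with_def)
  have "\<bar>foldr partial_deriv is g x\<bar> \<le> C\<^sub>g * ?w x" if "length is \<le> ?d" for "is" x
    using g(3)[of "count (mset is)" x] multi_deriv_count[OF C_diff_mono[OF g(2) that]] that by simp
  then have dom_g: "dominated ?d ?w g"
    using g(1,2) by (intro foldr_bound_imp_dominated[where K = C\<^sub>g]) auto
  \<comment> \<open>The assumption on \<open>\<tau>\<close> starts at order 1, so it is phrased for
    first partial derivatives: up to \<open>k\<close> further ones give total order between 1 and
    \<open>k + 1\<close>, which is at most \<open>d\<close>.\<close>
  have dom_\<tau>: "dominated k ?e (partial_deriv i (\<lambda>x. \<tau> x $ j))" if "k < ?d" for k i j
  proof (rule foldr_bound_imp_dominated)
    have "C_diff (Suc k) (\<lambda>x. \<tau> x $ j)"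
      using that by (intro C_diff_nth C_diff_mono[OF \<tau>]) simp
    then show "C_diff k (partial_deriv i (\<lambda>x. \<tau> x $ j))"
      by simp
    show "\<bar>foldr partial_deriv is (partial_deriv i (\<lambda>x. \<tau> x $ j)) x\<bar> \<le> B\<^sub>\<tau> * ?e x" if "length is \<le> k" for "is" x
    proof -
      have l: "length (is @ [i]) \<le> ?d"
        using that \<open>k < ?d\<close> by simp
      then have "C_diff (length (is @ [i])) (\<lambda>x. \<tau> x $ j)"
        by (intro C_diff_nth C_diff_mono[OF \<tau>])
      from multi_deriv_count[OF this] assms(4)[of "count (mset (is @ [i]))" j x] l
      show ?thesis
        by simp
    qed
  qed (rule assms(2))
  have bound: "?w (\<tau> x) * ?e x ^ ?d \<le> exp (M\<^sub>g * C\<^sub>\<tau>') * exp ((M\<^sub>g * C\<^sub>\<tau> + real ?d * M\<^sub>\<tau>) * (norm x)\<^sup>2)" for x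
  proof -
    \<comment> \<open>An upper bound for the norm of \<open>\<tau> x\<close> serves nonnegative
      \<open>M\<^sub>g\<close>; for negative \<open>M\<^sub>g\<close> multiplication reverses the
      lower bound.\<close>
    have "M\<^sub>g * (norm (\<tau> x))\<^sup>2 \<le> M\<^sub>g * (C\<^sub>\<tau> * (norm x)\<^sup>2 + C\<^sub>\<tau>')"
    proof (cases "M\<^sub>g \<ge> 0")
      case True
      then show ?thesis using assms(7) by (intro mult_left_mono)
    next
      case False
      then show ?thesis using assms(8) by (intro mult_left_mono_neg) auto
    qed
    then show ?thesis
      by (simp add: algebra_simps flip: exp_add exp_of_nat_mult)
  qed
  \<comment> \<open>Nonnegativity of \<open>M\<^sub>\<tau>\<close> gives
    \<open>1 \<le> ?e x\<close>. The power \<open>?d\<close> is the source of the summand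
    \<open>d * M\<^sub>\<tau>\<close> in the rate.\<close>
  have "dominated ?d (\<lambda>x. ?w (\<tau> x) * ?e x ^ ?d) (g \<circ> \<tau>)"
    using dom_g \<tau> dom_\<tau> assms(3) by (intro dominated_compose) auto
  then have dom: "dominated ?d (\<lambda>x. exp (M\<^sub>g * C\<^sub>\<tau>') * exp ((M\<^sub>g * C\<^sub>\<tau> + real ?d * M\<^sub>\<tau>) * (norm x)\<^sup>2)) (g \<circ> \<tau>)"
    by (rule dominated_mono) (rule bound)
  then obtain K where K: "K \<ge> 0" "\<And>is x. length is \<le> ?d \<Longrightarrow> \<bar>foldr partial_deriv is (g \<circ> \<tau>) x\<bar>
      \<le> K * (exp (M\<^sub>g * C\<^sub>\<tau>') * exp ((M\<^sub>g * C\<^sub>\<tau> + real ?d * M\<^sub>\<tau>) * (norm x)\<^sup>2))"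
    using dominated_imp_foldr_bound[OF dom] by auto
  \<comment> \<open>The added 1 makes the constant strictly positive even if \<open>K\<close> is 0;
    the exponential absorbs the additive constant \<open>C\<^sub>\<tau>'\<close>.\<close>
  let ?C = "(K + 1) * exp (M\<^sub>g * C\<^sub>\<tau>')"
  have "\<bar>multi_deriv a (g \<circ> \<tau>) x\<bar> \<le> ?C * exp ((M\<^sub>g * C\<^sub>\<tau> + real ?d * M\<^sub>\<tau>) * (norm x)\<^sup>2)"
    if "multi_order a \<le> ?d" for a x
    using K(2)[of "multi_index_list a" x] that
    by (auto simp: multi_deriv_eq_foldr length_multi_index_list mult.assoc
        elim!: order_trans intro!: mult_right_mono)
  then have "growth_condition_with (M\<^sub>g * C\<^sub>\<tau> + real ?d * M\<^sub>\<tau>) ?C (g \<circ> \<tau>)"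
    using K(1) dominated_imp_C_diff[OF dom] by (simp add: growth_condition_with_def)
  then show ?thesis
    unfolding growth_condition_def by blast
qed

end
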